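(* Let $a\ge0$ and $k\in\mathbb N$, $k\ge1$. Let $\Omega^\star\subset\mathbb R^{k+1}$ be a bounded, connected open set, symmetric with respect to the hyperplane $\{r=0\}$, such that $J:=\Omega^\star\cap\{(0,y)\mid y\in\mathbb R^k\}\neq\varnothing$. Suppose that $u\in C^2(\Omega^\star\setminus J)\cap C^1(\Omega^\star)$ is such that in a neighbourhood of any point of $J$ we have $u(r,y)=u(-r,y)$. If $L_au\ge0$ in $\Omega^\star\setminus J$, then $u$ satisfies the strong maximum principle in $\Omega^\star$: if there is a point $x_0\in\Omega^\star$ with $u(x_0)=\sup_{\Omega^\star}u$, then $u$ is constant in $\Omega^\star$.
   Context: Points of $\mathbb R^{k+1}=\mathbb R_r\times\mathbb R_y^k$ are written $(r,y)$. The Weinstein operator is $L_a u=\partial_{rr}u+\frac ar\partial_r u+\Delta_y u$ for $r\ne0$, with $\Delta_y$ the Laplacian in $y\in\mathbb R^k$. Symmetry with respect to $\{r=0\}$ means $(r,y)\in\Omega^\star\iff(-r,y)\in\Omega^\star$. *)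

theory Defs
  imports "HOL-Analysis.Analysis"
begin

definition partial_deriv ::
    "'a::real_normed_vector \<Rightarrow> ('a \<Rightarrow> real) \<Rightarrow> 'a \<Rightarrow> real" where
  "partial_deriv b f x = frechet_derivative f (at x) b"

(* The class C^n on S, meant for open S: the derivatives are full (at x, not at x within S). *)
primrec C_k_on :: "nat \<Rightarrow> ('a::euclidean_space \<Rightarrow> real) \<Rightarrow> 'a set \<Rightarrow> bool" where
  "C_k_on 0 f S \<longleftrightarrow> continuous_on S f"
| "C_k_on (Suc n) f S \<longleftrightarrow>
     (\<forall>x\<in>S. f differentiable (at x)) \<and> (\<forall>b\<in>Basis. C_k_on n (partial_deriv b f) S)"

definition d_r :: "(real \<times> (real^'k) \<Rightarrow> real) \<Rightarrow> real \<times> (real^'k) \<Rightarrow> real" where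
  "d_r = partial_deriv (1, 0)"

definition d_y :: "'k \<Rightarrow> (real \<times> (real^'k) \<Rightarrow> real) \<Rightarrow> real \<times> (real^'k) \<Rightarrow> real" where
  "d_y i = partial_deriv (0, axis i 1)"

definition laplacian_y :: "(real \<times> (real^'k) \<Rightarrow> real) \<Rightarrow> real \<times> (real^'k) \<Rightarrow> real" where
  "laplacian_y u x = (\<Sum>i\<in>UNIV. d_y i (d_y i u) x)"

(* Only meaningful at points x with fst x \<noteq> 0. *)
definition weinstein :: "real \<Rightarrow> (real \<times> (real^'k) \<Rightarrow> real) \<Rightarrow> real \<times> (real^'k) \<Rightarrow> real" where
  "weinstein a u x = d_r (d_r u) x + a / fst x * d_r u x + laplacian_y u x"

end

theory Submission
  imports Defs
begin

text \<open>The set \<open>Z\<close> where \<open>u\<close> attains its maximum is shown to be open. At a point of \<open>Z\<close>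
  the derivative of \<open>u\<close> vanishes, so by Hopf's boundary lemma it cannot lie on the boundary of a
  ball in which \<open>u\<close> stays below the maximum. Off the axis this is the classical argument. Hopf's
  lemma survives for balls tangent to \<open>{r = 0}\<close>, because the singular drift has a favourable sign
  there; hence near an axis point of \<open>Z\<close> each open half ball meets \<open>Z\<close>, and being connected is
  contained in it.\<close>

section \<open>Derivative tests at a local maximum\<close>

text \<open>If \<open>D\<close> were positive, \<open>g'\<close> would exceed
  \<open>g' 0 = 0\<close> just to the right of 0, and the mean value theorem would make
  \<open>g\<close> exceed \<open>g 0\<close> there. Only differentiability of \<open>g'\<close> at
  the single point 0 enters.\<close>

lemma local_max_second_derivative:
  fixes g g' :: "real \<Rightarrow> real"
  assumes g: "\<forall>\<^sub>F t in nhds 0. (g has_real_derivative g' t) (at t)"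
    and g': "(g' has_real_derivative D) (at 0)"
    and max: "\<forall>\<^sub>F t in nhds 0. g t \<le> g 0"
  shows "g' 0 = 0" "D \<le> 0"
proof -
  obtain d where d: "d > 0" "\<And>t. \<bar>t\<bar> < d \<Longrightarrow> (g has_real_derivative g' t) (at t)"
      "\<And>t. \<bar>t\<bar> < d \<Longrightarrow> g t \<le> g 0"
    using eventually_conj[OF g max] unfolding eventually_nhds_metric dist_real_def by auto
  show zero: "g' 0 = 0"
    using DERIV_local_max[OF d(2)[of 0] d(1)] d(1,3) by simp
  show "D \<le> 0"
  proof (rule ccontr)
    assume "\<not> D \<le> 0"
    then obtain e where e: "e > 0" "\<And>h. h > 0 \<Longrightarrow> h < e \<Longrightarrow> g' 0 < g' (0 + h)"
      using DERIV_pos_inc_right[OF g'] by auto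
    define t where "t = min d e / 2"
    have t: "0 < t" "t < d" "t < e"
      using d(1) e(1) by (auto simp: t_def)
    obtain z where z: "0 < z" "z < t" "g t - g 0 = (t - 0) * g' z"
      using MVT2[of 0 t g g'] t d(2) by auto
    have "g' z > 0"
      using e(2)[of z] z t zero by simp
    hence "g t > g 0"
      using mult_pos_pos[OF t(1) \<open>g' z > 0\<close>] z(3) by simp
    with d(3)[of t] t show False by simp
  qed
qed

lemma has_real_derivative_along_line:
  fixes f :: "'a::real_normed_vector \<Rightarrow> real"
  assumes "f differentiable (at (q + t *\<^sub>R b))"
  shows "((\<lambda>t. f (q + t *\<^sub>R b)) has_real_derivative partial_deriv b f (q + t *\<^sub>R b)) (at t)"
proof -
  let ?D = "frechet_derivative f (at (q + t *\<^sub>R b))"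
  have D: "(f has_derivative ?D) (at (q + t *\<^sub>R b))"
    using assms by (simp add: frechet_derivative_works)
  have "((\<lambda>t. q + t *\<^sub>R b) has_derivative (\<lambda>h. h *\<^sub>R b)) (at t)"
    by (auto intro!: derivative_eq_intros)
  from has_derivative_compose[OF this D]
  have "((\<lambda>t. f (q + t *\<^sub>R b)) has_derivative (\<lambda>h. ?D (h *\<^sub>R b))) (at t)" .
  moreover have "?D (h *\<^sub>R b) = partial_deriv b f (q + t *\<^sub>R b) * h" for h
    using linear_cmul[OF has_derivative_linear[OF D]]
    by (simp add: partial_deriv_def mult.commute)
  ultimately show ?thesis
    by (simp add: has_field_derivative_def)
qed

text \<open>Along the line through \<open>q\<close> in the unit direction \<open>b\<close>, the
  squared distance to \<open>c\<close> is a quadratic polynomial in \<open>t\<close>, so the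
  one-variable test applies to an explicit function. The right-hand sides are
  \<open>- \<epsilon>\<close> times the first and second \<open>b\<close>-derivatives of the
  Gaussian at \<open>q\<close>.\<close>

lemma partial_derivs_at_local_max:
  fixes u :: "'a::euclidean_space \<Rightarrow> real" and c q b :: 'a and \<alpha> \<epsilon> :: real
  defines "E \<equiv> exp (- \<alpha> * (norm (q - c))\<^sup>2)" and "\<beta> \<equiv> (q - c) \<bullet> b"
  assumes C2: "C_k_on 2 u S" and "open S" "q \<in> S" and b: "b \<in> Basis"
    and max: "\<forall>\<^sub>F x in nhds q. u x + \<epsilon> * exp (- \<alpha> * (norm (x - c))\<^sup>2) \<le> u q + \<epsilon> * E"
  shows "partial_deriv b u q = 2 * \<alpha> * \<epsilon> * \<beta> * E"
    and "partial_deriv b (partial_deriv b u) q \<le> \<epsilon> * (2 * \<alpha> - 4 * \<alpha>\<^sup>2 * \<beta>\<^sup>2) * E"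
proof -
  let ?l = "\<lambda>t. q + t *\<^sub>R b"
  let ?h = "\<lambda>t. exp (- \<alpha> * ((norm (q - c))\<^sup>2 + 2 * t * \<beta> + t\<^sup>2))"
  have norm_l: "(norm (?l t - c))\<^sup>2 = (norm (q - c))\<^sup>2 + 2 * t * \<beta> + t\<^sup>2" for t
    using b unfolding power2_norm_eq_inner \<beta>_def
    by (simp add: inner_simps inner_commute power2_eq_square algebra_simps)
  define g where "g t = u (?l t) + \<epsilon> * ?h t" for t
  define g' where "g' t = partial_deriv b u (?l t) - 2 * \<epsilon> * \<alpha> * (\<beta> + t) * ?h t" for t
  have diff: "u differentiable (at x)" "partial_deriv b u differentiable (at x)" if "x \<in> S" for x
    using C2 b that by (auto simp: numeral_2_eq_2)
  have lim: "(?l \<longlongrightarrow> q) (nhds 0)"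
    using tendsto_add[OF tendsto_const[of q] tendsto_scaleR[OF filterlim_ident tendsto_const[of b]], of 0]
    by simp
  have "\<forall>\<^sub>F x in nhds q. x \<in> S"
    using assms by (simp add: eventually_nhds_in_open)
  hence "\<forall>\<^sub>F t in nhds 0. ?l t \<in> S"
    by (rule eventually_compose_filterlim[OF _ lim])
  hence 1: "\<forall>\<^sub>F t in nhds 0. (g has_real_derivative g' t) (at t)"
  proof eventually_elim
    case (elim t)
    show ?case
      unfolding g_def g'_def
      by (rule derivative_eq_intros has_real_derivative_along_line diff elim refl | simp add: algebra_simps)+
  qed
  have 2: "(g' has_real_derivative
      partial_deriv b (partial_deriv b u) q - \<epsilon> * (2 * \<alpha> - 4 * \<alpha>\<^sup>2 * \<beta>\<^sup>2) * E) (at 0)"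
    using has_real_derivative_along_line[of "partial_deriv b u" q 0 b] diff[OF \<open>q \<in> S\<close>]
    unfolding g'_def E_def
    by (auto intro!: derivative_eq_intros simp: algebra_simps power2_eq_square)
  have "\<forall>\<^sub>F t in nhds 0. g t \<le> g 0"
    using eventually_compose_filterlim[OF max lim]
    by (simp add: g_def E_def norm_l)
  note local_max_second_derivative[OF 1 2 this]
  thus "partial_deriv b u q = 2 * \<alpha> * \<epsilon> * \<beta> * E"
    and "partial_deriv b (partial_deriv b u) q \<le> \<epsilon> * (2 * \<alpha> - 4 * \<alpha>\<^sup>2 * \<beta>\<^sup>2) * E"
    by (auto simp: g'_def E_def)
qed

section \<open>The Weinstein operator at a maximum of a Gaussian perturbation\<close>

text \<open>The bound is \<open>- \<epsilon>\<close> times the Weinstein operator of the Gaussian at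
  \<open>q\<close>. Second derivatives are only estimated, but the first-order condition is an
  equation, so the drift is computed exactly whatever the sign of \<open>a / fst q\<close>.\<close>

lemma weinstein_at_local_max:
  fixes u :: "real \<times> (real^'k) \<Rightarrow> real" and c q :: "real \<times> (real^'k)" and \<alpha> \<epsilon> :: real
  defines "E \<equiv> exp (- \<alpha> * (norm (q - c))\<^sup>2)"
  assumes "C_k_on 2 u S" "open S" "q \<in> S" "fst q \<noteq> 0"
    and "\<forall>\<^sub>F x in nhds q. u x + \<epsilon> * exp (- \<alpha> * (norm (x - c))\<^sup>2) \<le> u q + \<epsilon> * E"
  shows "weinstein a u q \<le>
    2 * \<alpha> * \<epsilon> * E * (real CARD('k) + 1 + a - 2 * \<alpha> * (norm (q - c))\<^sup>2 - a * (fst c / fst q))"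
proof -
  have basis: "(1, 0) \<in> (Basis :: (real \<times> (real^'k)) set)"
      "(0, axis i 1) \<in> (Basis :: (real \<times> (real^'k)) set)" for i
    by (auto simp: Basis_prod_def axis_in_Basis_iff)
  note max = partial_derivs_at_local_max[OF assms(2-4) _ assms(6)[unfolded E_def], folded E_def]
  define s where "s = fst (q - c)"
  define y where "y = snd (q - c)"
  have inner: "(q - c) \<bullet> (1, 0) = s" "(q - c) \<bullet> (0, axis i 1) = y $ i" for i
    by (simp_all add: s_def y_def inner_prod_def inner_axis)
  have norm: "(norm (q - c))\<^sup>2 = s\<^sup>2 + (\<Sum>i\<in>UNIV. (y $ i)\<^sup>2)"
    unfolding power2_norm_eq_inner inner_prod_def s_def y_def inner_vec_def
    by (simp add: power2_eq_square)
  have "laplacian_y u q \<le> (\<Sum>i\<in>UNIV. \<epsilon> * (2 * \<alpha> - 4 * \<alpha>\<^sup>2 * (y $ i)\<^sup>2) * E)"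
    unfolding laplacian_y_def d_y_def
    by (intro sum_mono max(2)[OF basis(2), unfolded inner])
  also have "\<dots> = \<epsilon> * (2 * \<alpha> * real CARD('k) - 4 * \<alpha>\<^sup>2 * (\<Sum>i\<in>UNIV. (y $ i)\<^sup>2)) * E"
    by (simp add: sum_subtractf sum_distrib_left sum_distrib_right algebra_simps)
  finally have lap: "laplacian_y u q \<le> \<dots>" .
  have "d_r u q = 2 * \<alpha> * \<epsilon> * s * E"
    unfolding d_r_def using max(1)[OF basis(1), unfolded inner] .
  hence drift: "a / fst q * d_r u q = 2 * \<alpha> * \<epsilon> * E * (a - a * (fst c / fst q))"
    using \<open>fst q \<noteq> 0\<close> by (simp only: s_def) (simp add: field_simps)
  have "d_r (d_r u) q \<le> \<epsilon> * (2 * \<alpha> - 4 * \<alpha>\<^sup>2 * s\<^sup>2) * E"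
    unfolding d_r_def using max(2)[OF basis(1), unfolded inner] .
  with lap show ?thesis
    unfolding weinstein_def drift norm by (simp add: algebra_simps power2_eq_square)
qed

section \<open>Hopf's boundary lemma up to the axis\<close>

text \<open>The projection \<open>fst\<close> does not increase distances, so the open ball stays on
  one side of \<open>r = 0\<close>, tangency included. Positivity of the quotient also excludes
  \<open>fst x = 0\<close>, because division by zero gives 0.\<close>

lemma ball_same_side:
  fixes c x :: "real \<times> 'b::real_normed_vector"
  assumes "x \<in> ball c R" "R \<le> \<bar>fst c\<bar>"
  shows "fst c / fst x > 0"
proof -
  have "\<bar>fst c - fst x\<bar> < \<bar>fst c\<bar>"
    using assms dist_fst_le[of c x] by (auto simp: dist_real_def)
  thus ?thesis
    by (auto simp: zero_less_divide_iff)
qed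

text \<open>The drift only helps the barrier: \<open>(a/r) \<partial>\<^sub>r\<close> contributes
  \<open>-2 \<alpha> a (r - r\<^sub>c)/r\<close> (times the exponential), and \<open>r\<^sub>c/r > 0\<close> bounds this
  below by \<open>-2 \<alpha> a\<close> even where the ball touches \<open>{r = 0}\<close>.\<close>

lemma weinstein_hopf_lemma:
  fixes u :: "real \<times> (real^'k) \<Rightarrow> real" and c p :: "real \<times> (real^'k)"
  assumes "a \<ge> 0" "R > 0" "R \<le> \<bar>fst c\<bar>"
    and C2: "C_k_on 2 u (ball c R)" and cont: "continuous_on (cball c R) u"
    and sub: "\<And>x. x \<in> ball c R \<Longrightarrow> weinstein a u x \<ge> 0"
    and less: "\<And>x. x \<in> ball c R \<Longrightarrow> u x < u p"
    and p: "dist c p = R" and D: "(u has_derivative D) (at p)"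
  shows "D (c - p) < 0"
proof -
  \<comment> \<open>Beyond distance \<open>R / 2\<close> from \<open>c\<close>, the term
    \<open>2 * \<alpha> * (norm (q - c))\<^sup>2\<close> is at least
    \<open>\<alpha> * R\<^sup>2 / 2\<close>, which this choice makes larger than
    \<open>real CARD('k) + 1 + a\<close>; the final \<open>+ 1\<close> gives strictness.\<close>
  define \<alpha> where "\<alpha> = (2 * (real CARD('k) + 1 + a) + 1) / R\<^sup>2"
  have \<alpha>: "\<alpha> > 0" "\<alpha> * R\<^sup>2 > 2 * (real CARD('k) + 1 + a)"
    using assms(1,2) by (auto simp: \<alpha>_def intro!: divide_pos_pos add_nonneg_pos)
  \<comment> \<open>Hopf's barrier: positive inside the ball, zero on its boundary sphere.\<close>
  define v where "v x = exp (- \<alpha> * (norm (x - c))\<^sup>2) - exp (- \<alpha> * R\<^sup>2)" for x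
  have v_le: "v x \<le> 1" for x
    using \<alpha>(1) by (simp add: v_def) (smt (verit) exp_gt_zero exp_le_one_iff mult_nonneg_nonneg zero_le_power2)
  have le: "u x \<le> u p" if "x \<in> cball c R" for x
    using continuous_le_on_closure[of "ball c R" u x "u p"] cont less that \<open>R > 0\<close>
    by (force simp: closure_ball)
  have "compact (sphere c (R / 2))" "sphere c (R / 2) \<noteq> {}"
    using \<open>R > 0\<close> by auto
  moreover have "continuous_on (sphere c (R / 2)) u"
    by (rule continuous_on_subset[OF cont]) (use \<open>R > 0\<close> in auto)
  ultimately obtain z where z: "z \<in> sphere c (R / 2)" "\<And>x. x \<in> sphere c (R / 2) \<Longrightarrow> u x \<le> u z"
    using continuous_attains_sup by metis
  \<comment> \<open>The smallest gap below \<open>u p\<close> on the inner sphere, positive by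
    compactness. Since \<open>v \<le> 1\<close>, adding \<open>\<epsilon> * v\<close> cannot lift
    \<open>u\<close> above \<open>u p\<close> there.\<close>
  define \<epsilon> where "\<epsilon> = u p - u z"
  have "\<epsilon> > 0"
    using less[of z] z(1) \<open>R > 0\<close> by (auto simp: \<epsilon>_def)
  let ?A = "cball c R - ball c (R / 2)"
  \<comment> \<open>A maximum point \<open>q\<close> of the perturbed function with value above
    \<open>u p\<close> is excluded on the inner sphere by the choice of \<open>\<epsilon>\<close>,
    on the outer one because \<open>v\<close> vanishes, and in between because the Weinstein
    operator of \<open>u\<close> would be negative at \<open>q\<close>.\<close>
  have annulus: "u x + \<epsilon> * v x \<le> u p" if x: "x \<in> ?A" for x
  proof -
    have A: "compact ?A"
      by (intro compact_diff) auto
    have cont_A: "continuous_on ?A (\<lambda>x. u x + \<epsilon> * v x)"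
      unfolding v_def by (intro continuous_intros continuous_on_subset[OF cont]) auto
    obtain q where q: "q \<in> ?A" "\<And>x. x \<in> ?A \<Longrightarrow> u x + \<epsilon> * v x \<le> u q + \<epsilon> * v q"
      using continuous_attains_sup[OF A _ cont_A] x by blast
    have "u q + \<epsilon> * v q \<le> u p"
    proof (rule ccontr)
      assume *: "\<not> u q + \<epsilon> * v q \<le> u p"
      have "dist c q \<noteq> R / 2"
      proof
        assume "dist c q = R / 2"
        hence "u q \<le> u p - \<epsilon>"
          using z(2)[of q] by (simp add: \<epsilon>_def)
        moreover have "\<epsilon> * v q \<le> \<epsilon>"
          using v_le[of q] \<open>\<epsilon> > 0\<close> by simp
        ultimately show False using * by simp
      qed
      moreover have "dist c q \<noteq> R"
        using * le[of q] q(1) by (auto simp: v_def dist_norm norm_minus_commute)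
      ultimately have q': "q \<in> ball c R" "R / 2 < dist c q"
        using q(1) by auto
      have "open (ball c R - cball c (R / 2))"
        by auto
      moreover have "q \<in> ball c R - cball c (R / 2)"
        using q' by auto
      ultimately have "\<forall>\<^sub>F x in nhds q. x \<in> ball c R - cball c (R / 2)"
        by (rule eventually_nhds_in_open)
      hence max: "\<forall>\<^sub>F x in nhds q. u x + \<epsilon> * exp (- \<alpha> * (norm (x - c))\<^sup>2)
          \<le> u q + \<epsilon> * exp (- \<alpha> * (norm (q - c))\<^sup>2)"
      proof eventually_elim
        case (elim x)
        thus ?case using q(2)[of x] by (auto simp: v_def algebra_simps)
      qed
      have pos: "fst c / fst q > 0"
        using ball_same_side[OF q'(1) assms(3)] .
      have "(R / 2)\<^sup>2 \<le> (norm (q - c))\<^sup>2"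
        using q'(2) \<open>R > 0\<close> by (intro power_mono) (auto simp: dist_norm norm_minus_commute)
      hence "\<alpha> * R\<^sup>2 \<le> \<alpha> * (4 * (norm (q - c))\<^sup>2)"
        using \<alpha>(1) by (simp add: power_divide)
      moreover have "a * (fst c / fst q) \<ge> 0"
        using pos assms(1) by (intro mult_nonneg_nonneg) auto
      ultimately have "real CARD('k) + 1 + a - 2 * \<alpha> * (norm (q - c))\<^sup>2 - a * (fst c / fst q) < 0"
        using \<alpha>(2) by simp
      hence "2 * \<alpha> * \<epsilon> * exp (- \<alpha> * (norm (q - c))\<^sup>2) *
          (real CARD('k) + 1 + a - 2 * \<alpha> * (norm (q - c))\<^sup>2 - a * (fst c / fst q)) < 0"
        using \<alpha>(1) \<open>\<epsilon> > 0\<close> by (intro mult_pos_neg) auto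
      with weinstein_at_local_max[OF C2 open_ball q'(1) _ max, of a] pos sub[OF q'(1)]
      show False by force
    qed
    with q(2)[OF x] show ?thesis by linarith
  qed
  \<comment> \<open>The perturbed function on the inward radial segment from \<open>p\<close>, at
    distance \<open>(1 - t) * R\<close> from \<open>c\<close>; for \<open>t \<le> 1 / 2\<close> it
    stays in the annulus. As \<open>g\<close> is largest at \<open>t = 0\<close> there, its
    derivative at 0 is not positive, while the barrier contributes a positive amount to it; hence
    the contribution of \<open>u\<close> is strictly negative.\<close>
  define g where "g t = u (p + t *\<^sub>R (c - p)) + \<epsilon> * (exp (- \<alpha> * ((1 - t) * R)\<^sup>2) - exp (- \<alpha> * R\<^sup>2))" for t
  have g_le: "g t \<le> g 0" if "0 \<le> t" "t \<le> 1 / 2" for t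
  proof -
    have "p + t *\<^sub>R (c - p) - c = (1 - t) *\<^sub>R (p - c)"
      by (simp add: algebra_simps)
    hence n: "norm (p + t *\<^sub>R (c - p) - c) = (1 - t) * R"
      using p that by (simp add: dist_norm norm_minus_commute)
    moreover have "(1 - t) * R \<le> R" "R / 2 \<le> (1 - t) * R"
      using that \<open>R > 0\<close> by (auto simp: mult_le_cancel_right1 field_simps)
    ultimately have "p + t *\<^sub>R (c - p) \<in> ?A"
      by (simp add: dist_norm norm_minus_commute)
    from annulus[OF this] show ?thesis
      unfolding v_def n by (simp add: g_def)
  qed
  have "D = frechet_derivative u (at p)" "u differentiable (at p)"
    using D frechet_derivative_at by (blast, auto simp: differentiable_def)
  hence "(g has_real_derivative D (c - p) + 2 * \<alpha> * \<epsilon> * R\<^sup>2 * exp (- \<alpha> * R\<^sup>2)) (at 0)"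
    using has_real_derivative_along_line[of u p 0 "c - p"]
    unfolding g_def partial_deriv_def
    by (auto intro!: derivative_eq_intros simp: algebra_simps power2_eq_square)
  moreover have "\<exists>h>0. h < d \<and> g (0 + h) \<le> g 0" if "d > 0" for d
    using g_le[of "min (d / 2) (1 / 2)"] that by (intro exI[of _ "min (d / 2) (1 / 2)"]) auto
  ultimately have "\<not> 0 < D (c - p) + 2 * \<alpha> * \<epsilon> * R\<^sup>2 * exp (- \<alpha> * R\<^sup>2)"
    by (metis DERIV_pos_inc_right not_le)
  moreover have "2 * \<alpha> * \<epsilon> * R\<^sup>2 * exp (- \<alpha> * R\<^sup>2) > 0"
    using \<alpha>(1) \<open>\<epsilon> > 0\<close> \<open>R > 0\<close> by simp
  ultimately show ?thesis by linarith
qed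

section \<open>Balls touching the maximum set\<close>

lemma C_k_on_subset: "C_k_on n f S \<Longrightarrow> T \<subseteq> S \<Longrightarrow> C_k_on n f T"
  by (induction n arbitrary: f) (auto intro: continuous_on_subset)

text \<open>The derivative of \<open>u\<close> vanishes at the interior maximum \<open>p\<close>,
  whereas Hopf's lemma would make it negative in the direction \<open>c - p\<close> if
  \<open>u\<close> stayed below \<open>u p\<close> in the open ball. The point \<open>p\<close>
  itself may lie on the axis.\<close>

lemma weinstein_touching_ball:
  fixes u :: "real \<times> (real^'k) \<Rightarrow> real" and c p :: "real \<times> (real^'k)"
  assumes "a \<ge> 0" "open \<Omega>"
    and C2: "C_k_on 2 u (\<Omega> \<inter> {x. fst x \<noteq> 0})"
    and diff: "\<And>x. x \<in> \<Omega> \<Longrightarrow> u differentiable (at x)"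
    and sub: "\<And>x. x \<in> \<Omega> \<Longrightarrow> fst x \<noteq> 0 \<Longrightarrow> weinstein a u x \<ge> 0"
    and le: "\<And>x. x \<in> \<Omega> \<Longrightarrow> u x \<le> u p"
    and ball: "0 < R" "R \<le> \<bar>fst c\<bar>" "cball c R \<subseteq> \<Omega>" and p: "dist c p = R"
  shows "\<exists>x\<in>ball c R. u x = u p"
proof (rule ccontr)
  assume "\<not> ?thesis"
  hence less: "u x < u p" if "x \<in> ball c R" for x
    using le[of x] ball(3) ball_subset_cball that by (metis order.not_eq_order_implies_strict subsetD)
  have sub_ball: "ball c R \<subseteq> \<Omega> \<inter> {x. fst x \<noteq> 0}"
    using ball_same_side[OF _ ball(2)] ball(3) by fastforce
  have "p \<in> \<Omega>"
    using p ball by auto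
  then obtain D where D: "(u has_derivative D) (at p)"
    using diff unfolding differentiable_def by blast
  have "continuous_on (cball c R) u"
    using ball(3) diff differentiable_imp_continuous_within
    by (intro continuous_at_imp_continuous_on) blast
  hence "D (c - p) < 0"
    using weinstein_hopf_lemma[OF assms(1) ball(1,2) C_k_on_subset[OF C2 sub_ball] _ _ less p D]
      sub sub_ball by blast
  moreover obtain e where "e > 0" "ball p e \<subseteq> \<Omega>"
    using \<open>open \<Omega>\<close> \<open>p \<in> \<Omega>\<close> openE by blast
  hence "D = (\<lambda>v. 0)"
    using differential_zero_maxmin[OF centre_in_ball[THEN iffD2] open_ball D] le by blast
  ultimately show False by simp
qed

section \<open>Propagation of the maximum set through the domain\<close>

theorem theorem3p1:
  fixes a :: real
    and \<Omega> J :: "(real \<times> (real^'k)) set"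
    and u :: "real \<times> (real^'k) \<Rightarrow> real"
    and x\<^sub>0 :: "real \<times> (real^'k)"
  assumes "a \<ge> 0"
    and "bounded \<Omega>" and "connected \<Omega>" and "open \<Omega>"
    and "\<forall>r y. (r, y) \<in> \<Omega> \<longleftrightarrow> (- r, y) \<in> \<Omega>"
    and "J = \<Omega> \<inter> {(0, y) | y. True}" and "J \<noteq> {}"
    and "C_k_on 2 u (\<Omega> - J)" and "C_k_on 1 u \<Omega>"
    and "\<forall>p\<in>J. \<forall>\<^sub>F (r, y) in nhds p. u (r, y) = u (- r, y)"
    and "\<forall>x\<in>\<Omega> - J. weinstein a u x \<ge> 0"
    and "x\<^sub>0 \<in> \<Omega>" and "ereal (u x\<^sub>0) = (SUP x\<in>\<Omega>. ereal (u x))"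
  shows "u constant_on \<Omega>"
proof -
  have off: "\<Omega> - J = \<Omega> \<inter> {x. fst x \<noteq> 0}"
    using assms(6) by force
  have C2: "C_k_on 2 u (\<Omega> \<inter> {x. fst x \<noteq> 0})"
    using assms(8) off by simp
  have diff: "u differentiable (at x)" if "x \<in> \<Omega>" for x
    using assms(9) that by simp
  have sub: "weinstein a u x \<ge> 0" if "x \<in> \<Omega>" "fst x \<noteq> 0" for x
    using assms(11) off that by blast
  have le: "u x \<le> u x\<^sub>0" if "x \<in> \<Omega>" for x
    using SUP_upper[OF that, of "\<lambda>x. ereal (u x)"] unfolding assms(13)[symmetric] by simp
  have cont: "continuous_on \<Omega> u"
    by (intro continuous_at_imp_continuous_on) (use diff differentiable_imp_continuous_within in blast)
  define Z where "Z = {x \<in> \<Omega>. u x = u x\<^sub>0}"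
  have Z_sub: "Z \<subseteq> \<Omega>"
    by (auto simp: Z_def)
  have Z_closed: "closedin (top_of_set \<Omega>) Z"
    unfolding Z_def by (rule continuous_closedin_preimage_constant[OF cont])
  have touch: "\<exists>x\<in>ball c R. x \<in> Z"
    if "p \<in> Z" "0 < R" "R \<le> \<bar>fst c\<bar>" "cball c R \<subseteq> \<Omega>" "dist c p = R" for c p R
  proof -
    have "\<And>x. x \<in> \<Omega> \<Longrightarrow> u x \<le> u p"
      using le that(1) by (simp add: Z_def)
    from weinstein_touching_ball[OF assms(1,4) C2 diff sub this that(2-5)]
    obtain x where "x \<in> ball c R" "u x = u p" by blast
    thus ?thesis
      using that(1,4) by (intro bexI[of _ x]) (auto simp: Z_def)
  qed

  have Z_off: "\<exists>e>0. ball z e \<subseteq> Z" if z: "z \<in> Z" "fst z \<noteq> 0" for z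
  proof -
    obtain e where e: "e > 0" "cball z e \<subseteq> \<Omega>"
      using \<open>open \<Omega>\<close> z(1) Z_sub open_contains_cball by blast
    \<comment> \<open>For \<open>x\<close> within \<open>d\<close> of \<open>z\<close>, a ball about
      \<open>x\<close> of radius less than \<open>d\<close> stays in \<open>cball z e\<close>
      because \<open>2 * d \<le> e\<close>, and off the axis because
      \<open>\<bar>fst x\<bar> > \<bar>fst z\<bar> - d \<ge> d\<close>.\<close>
    define d where "d = min (e / 2) (\<bar>fst z\<bar> / 2)"
    have d: "d > 0" "2 * d \<le> e" "2 * d \<le> \<bar>fst z\<bar>"
      using e(1) z(2) by (auto simp: d_def)
    \<comment> \<open>\<open>Z\<close> is closed only relative to \<open>\<Omega>\<close>; cutting
      it down to a closed ball inside \<open>\<Omega>\<close> gives a closed set, so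
      \<open>x\<close> has a nearest point \<open>p\<close> in it. The ball about \<open>x\<close>
      through \<open>p\<close> then contains a point of \<open>Z\<close> closer than
      \<open>p\<close>, a contradiction.\<close>
    let ?K = "Z \<inter> cball z e"
    have "closed ?K"
    proof -
      obtain T where "closed T" "Z = \<Omega> \<inter> T"
        using Z_closed closedin_closed by metis
      hence "?K = T \<inter> cball z e"
        using e(2) by blast
      thus ?thesis using \<open>closed T\<close> by auto
    qed
    have "x \<in> Z" if x: "x \<in> ball z d" for x
    proof (rule ccontr)
      assume "x \<notin> Z"
      have z_K: "z \<in> ?K"
        using z(1) e(1) by simp
      obtain p where p: "p \<in> ?K" "\<And>y. y \<in> ?K \<Longrightarrow> dist x p \<le> dist x y"
        using distance_attains_inf[OF \<open>closed ?K\<close>, of x] z_K by blast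
      let ?R = "dist x p"
      have "?R \<le> dist x z"
        by (rule p(2)[OF z_K])
      hence R: "?R < d"
        using x by (simp add: dist_commute)
      have in_e: "cball x ?R \<subseteq> cball z e"
      proof
        fix w assume "w \<in> cball x ?R"
        hence "dist z w < d + d"
          using R x dist_triangle[of z w x] by simp
        thus "w \<in> cball z e" using d by simp
      qed
      have "\<bar>fst z - fst x\<bar> < d"
        using x dist_fst_le[of z x] by (simp add: dist_real_def)
      hence "?R \<le> \<bar>fst x\<bar>"
        using R d by linarith
      moreover have "0 < ?R"
        using p(1) \<open>x \<notin> Z\<close> by auto
      ultimately obtain w where w: "w \<in> ball x ?R" "w \<in> Z"
        using touch[of p ?R x] p(1) in_e e(2) by blast
      hence "w \<in> ?K"
        using in_e ball_subset_cball by blast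
      from p(2)[OF this] w(1) show False by simp
    qed
    thus ?thesis using d(1) by blast
  qed

  \<comment> \<open>The sign \<open>\<sigma>\<close> selects the side. In the connected half ball,
    \<open>Z\<close> is relatively closed, and open by \<open>Z_off\<close>, so a single point of
    \<open>Z\<close> suffices.\<close>
  have half: "ball z e \<inter> {x. \<sigma> * fst x > 0} \<subseteq> Z"
    if hyps: "z \<in> Z" "fst z = 0" "ball z e \<subseteq> \<Omega>" "e > 0" "\<bar>\<sigma>\<bar> = 1" for z e and \<sigma> :: real
  proof -
    let ?H = "ball z e \<inter> {x. \<sigma> * fst x > 0}"
    have "convex {x :: real \<times> (real^'k). \<sigma> * fst x > 0}"
      using convex_halfspace_gt[of 0 "(\<sigma>, 0) :: real \<times> (real^'k)"] by (simp add: inner_prod_def)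
    hence "connected ?H"
      by (intro convex_connected convex_Int) auto
    moreover have "openin (top_of_set ?H) (?H \<inter> Z)"
    proof -
      have "open (?H \<inter> Z)"
        unfolding open_contains_ball
      proof
        fix x assume x: "x \<in> ?H \<inter> Z"
        have "open ?H"
          by (intro open_Int open_ball open_Collect_less continuous_intros)
        then obtain e1 where "e1 > 0" "ball x e1 \<subseteq> ?H"
          using x openE by blast
        moreover have "x \<in> Z" "fst x \<noteq> 0"
          using x by auto
        then obtain e2 where "e2 > 0" "ball x e2 \<subseteq> Z"
          using Z_off by blast
        ultimately show "\<exists>e>0. ball x e \<subseteq> ?H \<inter> Z"
          by (intro exI[of _ "min e1 e2"]) auto
      qed
      thus ?thesis by (auto intro: open_subset)
    qed
    moreover have "closedin (top_of_set ?H) (?H \<inter> Z)"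
      using Z_closed hyps(3) by (auto simp: closedin_closed)
    ultimately have "?H \<inter> Z = {} \<or> ?H \<inter> Z = ?H"
      unfolding connected_clopen by blast
    moreover have "?H \<inter> Z \<noteq> {}"
    proof -
      \<comment> \<open>The ball of radius \<open>e / 3\<close> about this centre is tangent to
        \<open>r = 0\<close> exactly at \<open>z\<close>, the borderline case
        \<open>R = \<bar>fst c\<bar>\<close> of \<open>touch\<close>; it fits in
        \<open>ball z e\<close> since \<open>2 * e / 3 < e\<close>.\<close>
      let ?c = "z + (\<sigma> * (e / 3), 0)"
      have cz: "dist ?c z = e / 3" "\<bar>fst ?c\<bar> = e / 3" "fst ?c = \<sigma> * (e / 3)"
        using hyps by (auto simp: dist_norm norm_Pair abs_mult)
      have c: "cball ?c (e / 3) \<subseteq> ball z e"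
      proof
        fix w assume "w \<in> cball ?c (e / 3)"
        thus "w \<in> ball z e"
          using dist_triangle[of z w ?c] cz(1) hyps(4) by (simp add: dist_commute)
      qed
      hence "cball ?c (e / 3) \<subseteq> \<Omega>"
        using hyps(3) by order
      then obtain x where x: "x \<in> ball ?c (e / 3)" "x \<in> Z"
        using touch[OF hyps(1) _ _ _ cz(1)] hyps(4) cz(2) by (metis order_refl divide_pos_pos zero_less_numeral)
      have "fst ?c / fst x > 0"
        using ball_same_side[OF x(1)] cz(2) by simp
      hence "\<sigma> * fst x > 0"
        using hyps(4) unfolding cz(3) by (auto simp: zero_less_divide_iff zero_less_mult_iff mult_less_0_iff)
      thus ?thesis using x c ball_subset_cball by blast
    qed
    ultimately show ?thesis by blast
  qed

  have Z_axis: "\<exists>e>0. ball z e \<subseteq> Z" if z: "z \<in> Z" "fst z = 0" for z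
  proof -
    obtain e where e: "e > 0" "ball z e \<subseteq> \<Omega>"
      using \<open>open \<Omega>\<close> z(1) Z_sub openE by blast
    have off_axis: "x \<in> Z" if "x \<in> ball z e" "fst x \<noteq> 0" for x
      using half[OF z e(2,1), of "sgn (fst x)"] that
      by (auto simp: abs_sgn_eq sgn_mult_self_eq zero_less_mult_iff)
    have "x \<in> Z" if x: "x \<in> ball z e" for x
    proof -
      \<comment> \<open>The half balls miss the points with \<open>fst x = 0\<close>; these are
        limits of the off-axis points \<open>s n\<close>, so continuity of \<open>u\<close> carries
        the maximal value over to them.\<close>
      define s where "s n = x + (1 / real (Suc n), 0)" for n
      have "(\<lambda>n. (1 / real (Suc n), 0 :: real^'k)) \<longlonglongrightarrow> (0, 0)"
        by (intro tendsto_Pair tendsto_const LIMSEQ_Suc lim_1_over_n)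
      from tendsto_add[OF tendsto_const this, of x] have s: "s \<longlonglongrightarrow> x"
        by (simp add: s_def[abs_def] zero_prod_def[symmetric])
      have "\<forall>\<^sub>F n in sequentially. s n \<in> ball z e"
        using topological_tendstoD[OF s open_ball x] .
      hence "\<forall>\<^sub>F n in sequentially. u (s n) = u x\<^sub>0" if "fst x = 0"
      proof eventually_elim
        case (elim n)
        thus ?case using off_axis[of "s n"] that by (auto simp: s_def Z_def)
      qed
      moreover have "(\<lambda>n. u (s n)) \<longlonglongrightarrow> u x"
        using isCont_tendsto_compose[OF differentiable_imp_continuous_within[OF diff] s] x e(2) by auto
      ultimately have "u x = u x\<^sub>0" if "fst x = 0"
        using that tendsto_cong[of "\<lambda>n. u (s n)" "\<lambda>_. u x\<^sub>0" sequentially "u x"]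
        by (simp add: tendsto_const_iff)
      thus ?thesis
        using off_axis[OF x] x e(2) by (auto simp: Z_def)
    qed
    thus ?thesis using e(1) by blast
  qed

  have "open Z"
    unfolding open_contains_ball using Z_off Z_axis by blast
  hence "openin (top_of_set \<Omega>) Z"
    using Z_sub by (simp add: open_subset)
  hence "Z = {} \<or> Z = \<Omega>"
    using Z_closed \<open>connected \<Omega>\<close> unfolding connected_clopen by blast
  moreover have "x\<^sub>0 \<in> Z"
    using assms(12) by (simp add: Z_def)
  ultimately show ?thesis
    unfolding constant_on_def Z_def by blast
qed

end
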